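(* Let $\mu$ be a Borel measure on $\mathbb{R}^d$. Suppose that $\mu$ is a frame spectral measure with frame spectrum $\Lambda\subset\mathbb{R}^d$. Then $$\dim \Lambda\le \overline{\dim}_e\, \mu,$$ where $\dim\Lambda$ is the (upper) Beurling dimension of $\Lambda$ and $\overline{\dim}_e\,\mu$ is the upper entropy dimension of $\mu$.
   Context: Frame spectral measure: a nonzero finite Borel measure $\mu$ on $\mathbb{R}^d$ is a frame spectral measure with frame spectrum $\Lambda$, where $\Lambda\subset\mathbb{R}^d$ is countable, if there are constants $0<A\le B<\infty$ (frame bounds) such that for every $f\in L^2(\mu)$, $A\|f\|_{L^2(\mu)}^2\le \sum_{\lambda\in\Lambda}\left|\int f(x)e^{-2\pi i\lambda\cdot x}\,d\mu(x)\right|^2\le B\|f\|_{L^2(\mu)}^2$. Beurling dimension: for $r>0$ put $\mathfrak{D}_r^+(\Lambda)=\limsup_{h\to\infty}\sup_{x\in\mathbb{R}^d}\frac{\#(\Lambda\cap B(x,h))}{h^r}$, where $B(x,h)$ is the open ball of radius $h$ centered at $x$. Then $\dim\Lambda=\sup\{r>0:\mathfrak{D}_r^+(\Lambda)>0\}$ (with $\sup\emptyset=0$), or equivalently $\dim\Lambda=\inf\{r>0:\mathfrak{D}_r^+(\Lambda)<+\infty\}$. Entropy dimension: $\mathcal{D}_n$ is the partition of $\mathbb{R}^d$ into the dyadic cubes $\prod_{j=1}^d\left[\frac{k_j}{2^n},\frac{k_j+1}{2^n}\right)$, $k_j\in\mathbb{Z}$. For a probability measure $\mu$, $H(\mu,\mathcal{D}_n)=\sum_{D\in\mathcal{D}_n}-\mu(D)\log_2\mu(D)\in[0,\infty]$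 (with $0\log 0=0$) and $\overline{\dim}_e\,\mu=\limsup_{n\to\infty}\frac1n H(\mu,\mathcal{D}_n)$. For a nonzero finite measure $\mu$, $\overline{\dim}_e\,\mu$ means the upper entropy dimension of the normalized probability measure $\mu/\mu(\mathbb{R}^d)$. *)

theory Defs
  imports "HOL-Analysis.Analysis"
begin

section \<open>Frame spectral measures\<close>

definition square_integrable :: "'a measure \<Rightarrow> ('a \<Rightarrow> complex) \<Rightarrow> bool" where
  "square_integrable \<mu> f \<longleftrightarrow>
     f \<in> borel_measurable \<mu> \<and> integrable \<mu> (\<lambda>x. (norm (f x))\<^sup>2)"

definition fourier_coeff ::
  "(real ^ 'd) measure \<Rightarrow> (real ^ 'd \<Rightarrow> complex) \<Rightarrow> real ^ 'd \<Rightarrow> complex" where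
  "fourier_coeff \<mu> f l =
     (LINT x|\<mu>. f x * exp (- (2 * complex_of_real pi * \<i> * complex_of_real (l \<bullet> x))))"

text \<open>The sum over \<open>\<Lambda>\<close> is taken in \<open>[0,\<infinity>]\<close> (type \<open>ennreal\<close>, where every family is
  summable), so the upper bound really asserts convergence; a real-valued
  infinite sum would be \<open>0\<close> when divergent.\<close>

definition frame_spectral_measure ::
  "(real ^ 'd) measure \<Rightarrow> (real ^ 'd) set \<Rightarrow> bool" where
  "frame_spectral_measure \<mu> \<Lambda> \<longleftrightarrow>
     sets \<mu> = sets borel \<and> finite_measure \<mu> \<and> emeasure \<mu> UNIV \<noteq> 0 \<and> countable \<Lambda> \<and>
     (\<exists>A B. 0 < A \<and> A \<le> B \<and>
       (\<forall>f. square_integrable \<mu> f \<longrightarrow>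
          ennreal (A * (LINT x|\<mu>. (norm (f x))\<^sup>2))
            \<le> (\<Sum>\<^sub>\<infinity>l\<in>\<Lambda>. ennreal ((norm (fourier_coeff \<mu> f l))\<^sup>2)) \<and>
          (\<Sum>\<^sub>\<infinity>l\<in>\<Lambda>. ennreal ((norm (fourier_coeff \<mu> f l))\<^sup>2))
            \<le> ennreal (B * (LINT x|\<mu>. (norm (f x))\<^sup>2))))"


section \<open>Beurling dimension\<close>

text \<open>Points are counted with the counting measure, which gives \<open>\<infinity>\<close> on infinite sets
  (whereas \<open>card\<close> would give \<open>0\<close>).\<close>

definition upper_beurling_density :: "real \<Rightarrow> (real ^ 'd) set \<Rightarrow> ennreal" where
  "upper_beurling_density r \<Lambda> =
     Limsup at_top (\<lambda>h::real. SUP x. emeasure (count_space UNIV) (\<Lambda> \<inter> ball x h) / ennreal (h powr r))"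

text \<open>In \<open>ennreal\<close> the supremum of the empty set is \<open>0\<close>.\<close>

definition beurling_dim :: "(real ^ 'd) set \<Rightarrow> ennreal" where
  "beurling_dim \<Lambda> = (SUP r\<in>{r. 0 < r \<and> 0 < upper_beurling_density r \<Lambda>}. ennreal r)"


section \<open>Entropy dimension\<close>

definition dyadic_cube :: "nat \<Rightarrow> int ^ 'd \<Rightarrow> (real ^ 'd) set" where
  "dyadic_cube n k =
     {x. \<forall>j. real_of_int (k $ j) / 2 ^ n \<le> x $ j \<and> x $ j < (real_of_int (k $ j) + 1) / 2 ^ n}"

definition dyadic_partition :: "nat \<Rightarrow> (real ^ 'd) set set" where
  "dyadic_partition n = range (dyadic_cube n)"

text \<open>Only meant for probability measures: then each summand is nonnegative, so \<open>ennreal\<close>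
  does not truncate it. The convention \<open>0 log 0 = 0\<close> holds since \<open>0 * y = 0\<close>.\<close>

definition partition_entropy :: "'a measure \<Rightarrow> 'a set set \<Rightarrow> ennreal" where
  "partition_entropy \<nu> P = (\<Sum>\<^sub>\<infinity>D\<in>P. ennreal (- (measure \<nu> D * log 2 (measure \<nu> D))))"

definition upper_entropy_dim_prob :: "(real ^ 'd) measure \<Rightarrow> ennreal" where
  "upper_entropy_dim_prob \<nu> =
     limsup (\<lambda>n. partition_entropy \<nu> (dyadic_partition n) / of_nat n)"

definition normalized_measure :: "'a measure \<Rightarrow> 'a measure" where
  "normalized_measure \<mu> = scale_measure (1 / emeasure \<mu> (space \<mu>)) \<mu>"

definition upper_entropy_dim :: "(real ^ 'd) measure \<Rightarrow> ennreal" where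
  "upper_entropy_dim \<mu> = upper_entropy_dim_prob (normalized_measure \<mu>)"

end

theory Submission
  imports Defs
begin

text \<open>Only the Bessel (upper) frame bound matters. Let \<open>D\<close> be a dyadic cube of side at most
  \<open>1 / (2 \<pi> d h)\<close> and \<open>E\<close> a finite subset of \<open>\<Lambda> \<inter> B(x, h)\<close>. For \<open>l \<in> E\<close> the phase of
  \<open>e\<^sub>l\<^sub>-\<^sub>x\<close> varies by at most \<open>1\<close> on \<open>D\<close>, so the Fourier coefficient at \<open>l\<close> of
  \<open>f = 1\<^sub>D e\<^sub>x\<close> has modulus at least \<open>\<mu>(D) cos 1 \<ge> \<mu>(D) / 2\<close>. Hence
  \<open>#E \<mu>(D)\<^sup>2 / 4 \<le> B \<mu>(D)\<close>, that is, \<open>\<mu>(D) \<le> 4 B / #E\<close> for every cube of that scale, and the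
  entropy at that scale is at least \<open>log\<^sub>2 #E\<close> up to an additive constant.\<close>

section \<open>Entropy of partitions with small cells\<close>

text \<open>Countable subadditivity, phrased with \<open>infsum\<close> to match
  \<open>partition_entropy\<close>. Finite unions along an enumeration of \<open>P\<close> increase
  to the whole space, so continuity from below reduces the claim to finite subadditivity.\<close>

lemma emeasure_space_le_infsum_cover:
  assumes "countable P" "P \<subseteq> sets M" "\<Union>P = space M"
  shows "emeasure M (space M) \<le> infsum (emeasure M) P"
proof (cases "P = {}")
  case True
  then show ?thesis using assms by simp
next
  case False
  \<comment> \<open>If \<open>P\<close> is finite, \<open>from_nat_into\<close> repeats cells;
    passing to the image set counts each cell only once.\<close>
  define U where "U n = \<Union> (from_nat_into P ` {..<n})" for n
  have in_P: "from_nat_into P i \<in> P" for i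
    using False by (rule from_nat_into)
  have UN: "(\<Union>n. U n) = space M"
  proof -
    have "(\<Union>n. U n) = \<Union> (range (from_nat_into P))"
      unfolding U_def by blast
    then show ?thesis
      using range_from_nat_into[OF False assms(1)] assms(3) by simp
  qed
  have bound: "emeasure M (U n) \<le> infsum (emeasure M) P" for n
  proof -
    have "emeasure M (U n) = emeasure M (\<Union>D\<in>from_nat_into P ` {..<n}. D)"
      by (simp add: U_def)
    also have "\<dots> \<le> sum (emeasure M) (from_nat_into P ` {..<n})"
      by (rule emeasure_subadditive_finite) (use in_P assms(2) in auto)
    also have "\<dots> = infsum (emeasure M) (from_nat_into P ` {..<n})"
      by simp
    also have "\<dots> \<le> infsum (emeasure M) P"
      by (rule infsum_mono_neutral) (use in_P in \<open>auto intro: nonneg_summable_on_complete\<close>)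
    finally show ?thesis .
  qed
  have "(SUP n. emeasure M (U n)) = emeasure M (\<Union>n. U n)"
  proof (rule SUP_emeasure_incseq)
    show "range U \<subseteq> sets M"
      using in_P assms(2) unfolding U_def by (auto intro!: sets.finite_UN)
    show "incseq U"
      unfolding U_def by (auto simp: incseq_def) (meson lessThan_iff order_less_le_trans)
  qed
  then show ?thesis
    using bound by (metis (mono_tags, lifting) SUP_least UN)
qed

text \<open>On every cell of positive mass the information \<open>- log 2 (measure \<nu> D)\<close>
  is at least \<open>- log 2 q\<close>; average this against the cell masses, whose sum is at least
  1 by the covering lemma. For \<open>q > 1\<close> the left side is truncated to 0.\<close>

lemma partition_entropy_ge:
  assumes prob: "emeasure \<nu> (space \<nu>) = 1" and "countable P" "P \<subseteq> sets \<nu>" "\<Union>P = space \<nu>" "0 < q"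
    and le: "\<And>D. D \<in> P \<Longrightarrow> measure \<nu> D \<le> q"
  shows "ennreal (- log 2 q) \<le> partition_entropy \<nu> P"
proof -
  interpret finite_measure \<nu>
    by (rule finite_measureI) (simp add: prob)
  have "ennreal (- log 2 q) = ennreal (- log 2 q) * emeasure \<nu> (space \<nu>)"
    by (simp add: prob)
  also have "\<dots> \<le> ennreal (- log 2 q) * infsum (emeasure \<nu>) P"
    by (intro mult_left_mono emeasure_space_le_infsum_cover assms) simp
  also have "\<dots> = (SUP F\<in>{F. finite F \<and> F \<subseteq> P}. ennreal (- log 2 q) * sum (emeasure \<nu>) F)"
    by (simp add: nonneg_infsum_complete SUP_mult_left_ennreal)
  also have "\<dots> = (SUP F\<in>{F. finite F \<and> F \<subseteq> P}. \<Sum>D\<in>F. ennreal (- log 2 q) * emeasure \<nu> D)"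
    by (simp add: sum_distrib_left)
  also have "\<dots> = (\<Sum>\<^sub>\<infinity>D\<in>P. ennreal (- log 2 q) * emeasure \<nu> D)"
    by (simp add: nonneg_infsum_complete)
  also have "\<dots> \<le> partition_entropy \<nu> P"
    unfolding partition_entropy_def
  proof (rule infsum_mono)
    fix D assume D: "D \<in> P"
    have "- log 2 q * measure \<nu> D \<le> - (measure \<nu> D * log 2 (measure \<nu> D))"
    proof (cases "measure \<nu> D = 0")
      case False
      then have "0 < measure \<nu> D" by (simp add: zero_less_measure_iff)
      moreover have "log 2 (measure \<nu> D) \<le> log 2 q"
        using calculation le[OF D] by simp
      ultimately show ?thesis by (simp add: mult.commute mult_left_mono)
    qed simp
    then have "ennreal (- log 2 q * measure \<nu> D) \<le> ennreal (- (measure \<nu> D * log 2 (measure \<nu> D)))"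
      by (rule ennreal_leI)
    \<comment> \<open>The product rule for \<open>ennreal\<close> holds even for
      \<open>q > 1\<close>: the second factor is nonnegative, and a negative first factor makes both
      sides 0.\<close>
    then show "ennreal (- log 2 q) * emeasure \<nu> D \<le> ennreal (- (measure \<nu> D * log 2 (measure \<nu> D)))"
      by (simp only: emeasure_eq_measure ennreal_mult''[OF measure_nonneg])
  qed (auto intro: nonneg_summable_on_complete)
  finally show ?thesis .
qed

section \<open>Fourier coefficients and the Bessel bound\<close>

lemma cos_ge_half: "1 / 2 \<le> cos t" if "\<bar>t\<bar> \<le> 1" for t :: real
proof -
  \<comment> \<open>The comparison point is \<open>pi / 3 > 1\<close>, where the cosine equals
    1/2.\<close>
  have "cos (pi / 3) \<le> cos \<bar>t\<bar>"
    using that pi_gt3 by (intro cos_monotone_0_pi_le) auto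
  then show ?thesis by (simp add: cos_60)
qed

text \<open>\<open>s\<close> is a reference phase. Rotated by \<open>cis (- s)\<close>, a change
  that preserves the modulus of the integral, the integrand on \<open>D\<close> stays within angle 1
  of the positive real axis. Its real part is then at least 1/2, so no cancellation occurs.\<close>

lemma norm_integral_cis_ge:
  assumes "finite_measure M" "D \<in> sets M" and [measurable]: "t \<in> borel_measurable M"
    and near: "\<And>y. y \<in> D \<Longrightarrow> \<bar>t y - s\<bar> \<le> 1"
  shows "measure M D / 2 \<le> norm (LINT y|M. indicator D y * cis (t y))"
proof -
  interpret finite_measure M by fact
  note [measurable] = assms(2)
  have int: "integrable M (\<lambda>y. indicator D y * cis (t y - s))"
  proof (rule integrable_const_bound[where B = 1])
    show "(\<lambda>y. indicator D y * cis (t y - s)) \<in> borel_measurable M"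
      unfolding cis_conv_exp by measurable
  qed (auto simp: norm_mult indicator_def)
  have "measure M D / 2 = (LINT y|M. indicator D y * (1 / 2))"
    using assms(2) by (simp add: sets.Int_space_eq2)
  also have "\<dots> \<le> (LINT y|M. Re (indicator D y * cis (t y - s)))"
  proof (rule integral_mono)
    show "integrable M (\<lambda>y. indicator D y * (1 / 2 :: real))"
      using assms(2) by (intro integrable_mult_left integrable_real_indicator) (auto simp: less_top[symmetric])
    show "integrable M (\<lambda>y. Re (indicator D y * cis (t y - s)))"
      using int by (rule integrable_Re)
    show "indicator D y * (1 / 2) \<le> Re (indicator D y * cis (t y - s))" for y
      using cos_ge_half[OF near, of y] by (simp add: indicator_def)
  qed
  also have "\<dots> = Re (LINT y|M. indicator D y * cis (t y - s))"
    using int by (rule integral_Re)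
  also have "(LINT y|M. indicator D y * cis (t y - s)) = (LINT y|M. cis (- s) * (indicator D y * cis (t y)))"
    by (simp only: mult.left_commute[of "cis (- s)"] cis_mult uminus_add_conv_diff)
  also have "\<dots> = cis (- s) * (LINT y|M. indicator D y * cis (t y))"
    by (rule integral_mult_right_zero)
  also have "Re \<dots> \<le> norm (cis (- s) * (LINT y|M. indicator D y * cis (t y)))"
    by (rule complex_Re_le_cmod)
  also have "\<dots> = norm (LINT y|M. indicator D y * cis (t y))"
    by (simp add: norm_mult)
  finally show ?thesis .
qed

text \<open>\<open>x\<close> recentres the frequencies and \<open>z\<close> fixes the reference
  phase, so only the differences \<open>l - x\<close> and \<open>y - z\<close> enter. A finite
  \<open>E\<close> bounds the full sum from below because all its terms are nonnegative.\<close>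

lemma bessel_card_measure_le:
  fixes \<mu> :: "(real ^ 'd) measure"
  assumes "finite_measure \<mu>" and sets: "sets \<mu> = sets borel"
    and bessel: "\<And>f. square_integrable \<mu> f \<Longrightarrow>
      (\<Sum>\<^sub>\<infinity>l\<in>\<Lambda>. ennreal ((norm (fourier_coeff \<mu> f l))\<^sup>2)) \<le> ennreal (B * (LINT x|\<mu>. (norm (f x))\<^sup>2))"
    and "0 \<le> B" "D \<in> sets \<mu>" "finite E" "E \<subseteq> \<Lambda>"
    and near: "\<And>l y. l \<in> E \<Longrightarrow> y \<in> D \<Longrightarrow> \<bar>2 * pi * ((l - x) \<bullet> (y - z))\<bar> \<le> 1"
  shows "card E * measure \<mu> D \<le> 4 * B"
proof -
  interpret finite_measure \<mu> by fact
  note [measurable] = assms(5)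
  note [measurable_cong] = sets
  define f :: "real ^ 'd \<Rightarrow> complex" where "f y = indicator D y * cis (2 * pi * (x \<bullet> y))" for y
  have norm_f: "(norm (f y))\<^sup>2 = indicator D y" for y
    by (simp add: f_def norm_mult indicator_def)
  have "integrable \<mu> (indicator D :: _ \<Rightarrow> real)"
    using assms(5) by (intro integrable_real_indicator) (auto simp: less_top[symmetric])
  moreover have "f \<in> borel_measurable \<mu>"
    unfolding f_def cis_conv_exp by measurable
  ultimately have f: "square_integrable \<mu> f"
    unfolding square_integrable_def norm_f by simp
  have norm_sq: "(LINT y|\<mu>. (norm (f y))\<^sup>2) = measure \<mu> D"
    unfolding norm_f using assms(5) by (simp add: sets.Int_space_eq2)
  have coeff: "(measure \<mu> D / 2)\<^sup>2 \<le> (norm (fourier_coeff \<mu> f l))\<^sup>2" if "l \<in> E" for l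
  proof -
    \<comment> \<open>The modulation in \<open>f\<close> shifts the frequency \<open>l\<close> to
      \<open>l - x\<close>.\<close>
    have eq: "fourier_coeff \<mu> f l = (LINT y|\<mu>. indicator D y * cis (- 2 * pi * ((l - x) \<bullet> y)))"
      unfolding fourier_coeff_def
      by (rule Bochner_Integration.integral_cong)
        (auto simp: f_def cis_conv_exp mult.assoc exp_add[symmetric] inner_diff_left algebra_simps)
    have "measure \<mu> D / 2 \<le> norm (fourier_coeff \<mu> f l)"
      unfolding eq
    proof (rule norm_integral_cis_ge[where s = "- 2 * pi * ((l - x) \<bullet> z)"])
      fix y assume "y \<in> D"
      have "- 2 * pi * ((l - x) \<bullet> y) - - 2 * pi * ((l - x) \<bullet> z) = - (2 * pi * ((l - x) \<bullet> (y - z)))"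
        by (simp add: inner_diff_right algebra_simps)
      then show "\<bar>- 2 * pi * ((l - x) \<bullet> y) - - 2 * pi * ((l - x) \<bullet> z)\<bar> \<le> 1"
        using near[OF that \<open>y \<in> D\<close>] by (simp only: abs_minus)
    qed (use assms in auto)
    then show ?thesis by (intro power_mono) auto
  qed
  have "ennreal (card E * (measure \<mu> D / 2)\<^sup>2) = (\<Sum>l\<in>E. ennreal ((measure \<mu> D / 2)\<^sup>2))"
    by (simp add: ennreal_mult ennreal_of_nat_eq_real_of_nat)
  also have "\<dots> \<le> (\<Sum>l\<in>E. ennreal ((norm (fourier_coeff \<mu> f l))\<^sup>2))"
    by (intro sum_mono ennreal_leI coeff)
  also have "\<dots> = (\<Sum>\<^sub>\<infinity>l\<in>E. ennreal ((norm (fourier_coeff \<mu> f l))\<^sup>2))"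
    using assms by simp
  also have "\<dots> \<le> (\<Sum>\<^sub>\<infinity>l\<in>\<Lambda>. ennreal ((norm (fourier_coeff \<mu> f l))\<^sup>2))"
    by (rule infsum_mono_neutral) (use assms in \<open>auto intro: nonneg_summable_on_complete\<close>)
  also have "\<dots> \<le> ennreal (B * measure \<mu> D)"
    using bessel[OF f] by (simp add: norm_sq)
  finally have "card E * (measure \<mu> D / 2)\<^sup>2 \<le> B * measure \<mu> D"
    using assms by (simp add: ennreal_le_iff)
  then have "measure \<mu> D * (card E * measure \<mu> D) \<le> measure \<mu> D * (4 * B)"
    by (simp add: power2_eq_square field_simps)
  \<comment> \<open>Cancel one factor \<open>measure \<mu> D\<close>; for a null set the claim is
    \<open>0 \<le> 4 * B\<close>.\<close>
  then show ?thesis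
    using \<open>0 \<le> B\<close> by (cases "measure \<mu> D = 0") (auto simp: zero_less_measure_iff)
qed

section \<open>Geometry of dyadic cubes\<close>

lemma sets_dyadic_cube: "dyadic_cube n k \<in> sets borel"
proof -
  have "dyadic_cube n k = (\<Inter>j. {x. real_of_int (k $ j) / 2 ^ n \<le> x $ j} \<inter> {x. x $ j < (real_of_int (k $ j) + 1) / 2 ^ n})"
    by (auto simp: dyadic_cube_def)
  also have "\<dots> \<in> sets borel"
    by (intro sets.finite_INT sets.Int borel_closed borel_open closed_halfspace_component_ge_cart
        open_halfspace_component_lt_cart) auto
  finally show ?thesis .
qed

lemma countable_dyadic_partition: "countable (dyadic_partition n)"
  unfolding dyadic_partition_def by simp

lemma Union_dyadic_partition: "\<Union> (dyadic_partition n) = UNIV"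
proof -
  have "x \<in> dyadic_cube n (\<chi> j. \<lfloor>2 ^ n * x $ j\<rfloor>)" for x :: "real ^ 'd"
    by (auto simp: dyadic_cube_def field_simps) linarith
  then show ?thesis unfolding dyadic_partition_def by blast
qed

text \<open>Relative to the lower corner, each coordinate is at most \<open>1 / 2 ^ n\<close>. The
  l1 bound on the norm gives the factor \<open>CARD('d)\<close>, and Cauchy-Schwarz
  finishes.\<close>

lemma dyadic_cube_inner_le:
  fixes v :: "real ^ 'd"
  assumes "y \<in> dyadic_cube n k"
  shows "\<bar>v \<bullet> (y - (\<chi> j. real_of_int (k $ j) / 2 ^ n))\<bar> \<le> norm v * (CARD('d) / 2 ^ n)"
proof -
  let ?w = "y - (\<chi> j. real_of_int (k $ j) / 2 ^ n)"
  have "\<bar>?w $ j\<bar> \<le> 1 / 2 ^ n" for j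
    using assms unfolding dyadic_cube_def by (auto simp: add_divide_distrib) (smt (verit))
  then have "norm ?w \<le> (\<Sum>j\<in>(UNIV :: 'd set). 1 / 2 ^ n)"
    by (intro order_trans[OF norm_le_l1_cart] sum_mono)
  then have "norm ?w \<le> CARD('d) / 2 ^ n" by simp
  then show ?thesis
    by (intro order_trans[OF Cauchy_Schwarz_ineq2] mult_left_mono) auto
qed

section \<open>Many spectrum points in large balls\<close>

text \<open>Were all finite counts eventually below \<open>c * h powr r\<close>, the limsup would be
  at most \<open>c\<close>, which is chosen strictly below the density. The witness \<open>E\<close>
  is a finite subset, since the ball may contain infinitely many points of
  \<open>\<Lambda>\<close>.\<close>

lemma upper_beurling_density_posD:
  assumes "0 < upper_beurling_density r \<Lambda>"
  obtains c :: real where "0 < c"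
    and "\<exists>\<^sub>F h in at_top. \<exists>x E. finite E \<and> E \<subseteq> \<Lambda> \<inter> ball x h \<and> c * h powr r \<le> card E"
proof -
  \<comment> \<open>The density may be infinite; a value strictly below it is still finite, hence a
    real number.\<close>
  obtain c where c: "0 < ennreal c" "ennreal c < upper_beurling_density r \<Lambda>"
  proof -
    obtain c' where "0 < c'" "c' < upper_beurling_density r \<Lambda>"
      using dense[OF assms] by blast
    moreover from this have "c' < top" by (simp add: order_less_le_trans)
    ultimately show thesis using that by (cases c') auto
  qed
  have "0 < c" using c(1) by simp
  moreover have "\<exists>\<^sub>F h in at_top. \<exists>x E. finite E \<and> E \<subseteq> \<Lambda> \<inter> ball x h \<and> c * h powr r \<le> card E"
  proof (rule ccontr)
    assume "\<not> ?thesis"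
    then have "\<forall>\<^sub>F h in at_top. \<forall>x E. finite E \<longrightarrow> E \<subseteq> \<Lambda> \<inter> ball x h \<longrightarrow> card E < c * h powr r"
      unfolding not_frequently by eventually_elim (meson not_le)
    then have "\<forall>\<^sub>F h in at_top. (SUP x. emeasure (count_space UNIV) (\<Lambda> \<inter> ball x h) / ennreal (h powr r)) \<le> ennreal c"
      using eventually_gt_at_top[of 0]
    proof eventually_elim
      case (elim h)
      show ?case
      proof (rule SUP_least)
        fix x
        let ?S = "\<Lambda> \<inter> ball x h"
        \<comment> \<open>An infinite intersection would contain a finite set of at least
          \<open>c * h powr r\<close> points, against the assumed bound.\<close>
        have fin: "finite ?S"
        proof (rule ccontr)
          assume "infinite ?S"
          then obtain E where "finite E" "card E = nat \<lceil>c * h powr r\<rceil>" "E \<subseteq> ?S"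
            using infinite_arbitrarily_large by blast
          with elim(1) have "real (nat \<lceil>c * h powr r\<rceil>) < c * h powr r" by metis
          then show False using real_nat_ceiling_ge[of "c * h powr r"] by linarith
        qed
        then have "card ?S / h powr r \<le> c"
          using elim(1)[rule_format, of ?S x] elim(2) by (simp add: divide_le_eq less_imp_le)
        then show "emeasure (count_space UNIV) ?S / ennreal (h powr r) \<le> ennreal c"
          using fin elim(2) by (simp add: emeasure_count_space_finite ennreal_of_nat_eq_real_of_nat
              divide_ennreal ennreal_leI)
      qed
    qed
    then have "upper_beurling_density r \<Lambda> \<le> ennreal c"
      unfolding upper_beurling_density_def by (rule Limsup_bounded)
    with c(2) show False by simp
  qed
  ultimately show thesis by (rule that)
qed

section \<open>Entropy of the normalized measure\<close>

lemma normalized_measure_simps: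
  assumes "finite_measure \<mu>" "emeasure \<mu> (space \<mu>) \<noteq> 0"
  shows "emeasure (normalized_measure \<mu>) (space (normalized_measure \<mu>)) = 1"
    and "measure (normalized_measure \<mu>) D = measure \<mu> D / measure \<mu> (space \<mu>)"
    and "sets (normalized_measure \<mu>) = sets \<mu>" "space (normalized_measure \<mu>) = space \<mu>"
proof -
  interpret finite_measure \<mu> by fact
  have pos: "0 < measure \<mu> (space \<mu>)"
    using assms(2) by (simp add: emeasure_eq_measure zero_less_measure_iff)
  \<comment> \<open>The total mass is a positive real, so its reciprocal in \<open>ennreal\<close>
    is the ordinary one.\<close>
  have eq: "normalized_measure \<mu> = scale_measure (ennreal (1 / measure \<mu> (space \<mu>))) \<mu>"
    using pos by (simp add: normalized_measure_def emeasure_eq_measure divide_ennreal flip: ennreal_1)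
  show "emeasure (normalized_measure \<mu>) (space (normalized_measure \<mu>)) = 1"
    using pos by (simp add: eq space_scale_measure emeasure_eq_measure flip: ennreal_mult)
  show "measure (normalized_measure \<mu>) D = measure \<mu> D / measure \<mu> (space \<mu>)"
    using pos by (simp add: measure_def eq enn2real_mult)
  show "sets (normalized_measure \<mu>) = sets \<mu>" "space (normalized_measure \<mu>) = space \<mu>"
    by (simp_all add: normalized_measure_def space_scale_measure)
qed

text \<open>\<open>C\<close> is \<open>4 * B / M\<close> with \<open>M\<close> the total mass. It
  does not depend on the scale, so its contribution vanishes once the entropy is divided by
  \<open>n\<close>. The condition on \<open>n\<close> keeps the phases of frequencies in
  \<open>ball x h\<close>, relative to \<open>x\<close>, within 1 of their value at the lower corner
  of the cube.\<close>

lemma frame_entropy_ge: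
  fixes \<mu> :: "(real ^ 'd) measure"
  assumes "frame_spectral_measure \<mu> \<Lambda>"
  obtains C :: real where "0 < C"
    and "\<And>n h x E. \<lbrakk>finite E; E \<subseteq> \<Lambda> \<inter> ball x h; E \<noteq> {}; 2 * pi * CARD('d) * h \<le> 2 ^ n\<rbrakk> \<Longrightarrow>
      ennreal (log 2 (card E / C)) \<le> partition_entropy (normalized_measure \<mu>) (dyadic_partition n)"
proof -
  from assms obtain A B where AB: "0 < A" "A \<le> B"
    and sets: "sets \<mu> = sets borel" and fin: "finite_measure \<mu>" and nz: "emeasure \<mu> UNIV \<noteq> 0"
    and bessel: "\<And>f. square_integrable \<mu> f \<Longrightarrow>
      (\<Sum>\<^sub>\<infinity>l\<in>\<Lambda>. ennreal ((norm (fourier_coeff \<mu> f l))\<^sup>2)) \<le> ennreal (B * (LINT x|\<mu>. (norm (f x))\<^sup>2))"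
    unfolding frame_spectral_measure_def by blast
  interpret finite_measure \<mu> by fact
  have space: "space \<mu> = UNIV"
    using sets_eq_imp_space_eq[OF sets] by simp
  define M where "M = measure \<mu> UNIV"
  have "0 < M"
    using nz unfolding M_def by (simp add: emeasure_eq_measure zero_less_measure_iff)
  note norm_simps = normalized_measure_simps[OF fin nz[folded space]]
  have "0 < 4 * B / M" using AB \<open>0 < M\<close> by simp
  moreover have "ennreal (log 2 (card E / (4 * B / M))) \<le> partition_entropy (normalized_measure \<mu>) (dyadic_partition n)"
    if E: "finite E" "E \<subseteq> \<Lambda> \<inter> ball x h" "E \<noteq> {}" and n: "2 * pi * CARD('d) * h \<le> 2 ^ n" for n h x E
  proof -
    have card: "0 < card E" using E by (simp add: card_gt_0_iff)
    \<comment> \<open>The Bessel estimate \<open>card E * measure \<mu> D \<le> 4 * B\<close>,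
      solved for the normalized mass of \<open>D\<close>.\<close>
    define q where "q = 4 * B / M / card E"
    have "ennreal (- log 2 q) \<le> partition_entropy (normalized_measure \<mu>) (dyadic_partition n)"
    proof (rule partition_entropy_ge)
      show "emeasure (normalized_measure \<mu>) (space (normalized_measure \<mu>)) = 1"
        by (rule norm_simps)
      show "dyadic_partition n \<subseteq> Sigma_Algebra.sets (normalized_measure \<mu>)"
        by (auto simp: norm_simps sets dyadic_partition_def sets_dyadic_cube)
      show "\<Union> (dyadic_partition n) = space (normalized_measure \<mu>)"
        by (simp add: norm_simps space Union_dyadic_partition)
      show "0 < q" using AB \<open>0 < M\<close> card by (simp add: q_def)
      fix D :: "(real ^ 'd) set" assume "D \<in> dyadic_partition n"
      then obtain k where D: "D = dyadic_cube n k"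
        by (auto simp: dyadic_partition_def)
      have "card E * measure \<mu> D \<le> 4 * B"
      proof (rule bessel_card_measure_le[OF fin sets bessel])
        fix l y assume "l \<in> E" "y \<in> D"
        let ?z = "(\<chi> j. real_of_int (k $ j) / 2 ^ n) :: real ^ 'd"
        have "norm (l - x) \<le> h"
          using E(2) \<open>l \<in> E\<close> by (auto simp: dist_norm norm_minus_commute)
        have "\<bar>2 * pi * ((l - x) \<bullet> (y - ?z))\<bar> \<le> 2 * pi * (norm (l - x) * (CARD('d) / 2 ^ n))"
          using dyadic_cube_inner_le[of y n k "l - x"] \<open>y \<in> D\<close>
          unfolding D abs_mult by (intro mult_mono) auto
        also have "\<dots> \<le> 2 * pi * (h * (CARD('d) / 2 ^ n))"
          using \<open>norm (l - x) \<le> h\<close> by (intro mult_left_mono mult_right_mono) auto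
        also have "\<dots> \<le> 1" using n by (simp add: field_simps)
        finally show "\<bar>2 * pi * ((l - x) \<bullet> (y - ?z))\<bar> \<le> 1" .
      qed (use AB E in \<open>auto simp: D sets sets_dyadic_cube\<close>)
      then show "measure (normalized_measure \<mu>) D \<le> q"
        using card \<open>0 < M\<close> by (simp add: norm_simps q_def space M_def[symmetric] field_simps)
    qed (rule countable_dyadic_partition)
    moreover have "- log 2 q = log 2 (card E / (4 * B / M))"
      using AB \<open>0 < M\<close> card by (simp add: q_def log_divide log_mult)
    ultimately show ?thesis by simp
  qed
  ultimately show thesis by (rule that)
qed

section \<open>Comparison of the two dimensions\<close>

theorem theorem1p2:
  fixes \<mu> :: "(real ^ 'd) measure" and \<Lambda> :: "(real ^ 'd) set"
  assumes "frame_spectral_measure \<mu> \<Lambda>"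
  shows "beurling_dim \<Lambda> \<le> upper_entropy_dim \<mu>"
  unfolding beurling_dim_def
proof (rule SUP_least)
  fix r :: real assume "r \<in> {r. 0 < r \<and> 0 < upper_beurling_density r \<Lambda>}"
  then have "0 < r" and dens: "0 < upper_beurling_density r \<Lambda>" by auto
  define H where "H n = partition_entropy (normalized_measure \<mu>) (dyadic_partition n)" for n
  define K where "K = 2 * pi * CARD('d)"
  have K: "1 \<le> K"
    using pi_ge_two mult_mono[of 1 "2 * pi" 1 "real CARD('d)"] by (simp add: K_def Suc_le_eq)
  obtain C where "0 < C"
    and entropy: "\<And>n h x E. \<lbrakk>finite E; E \<subseteq> \<Lambda> \<inter> ball x h; E \<noteq> {}; K * h \<le> 2 ^ n\<rbrakk> \<Longrightarrow>
      ennreal (log 2 (card E / C)) \<le> H n"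
    using frame_entropy_ge[OF assms] unfolding K_def H_def by blast
  obtain c where "0 < c"
    and freq: "\<exists>\<^sub>F h in at_top. \<exists>x E. finite E \<and> E \<subseteq> \<Lambda> \<inter> ball x h \<and> c * h powr r \<le> card E"
    using upper_beurling_density_posD[OF dens] .
  \<comment> \<open>Otherwise \<open>H n < s * n\<close> for all large \<open>n\<close> and some
    \<open>s < r\<close>. At a large scale \<open>h\<close> with many points and \<open>n\<close>
    about \<open>log 2 (K * h)\<close>, the entropy is, up to additive constants, at least
    \<open>r * log 2 h\<close> but below \<open>s * log 2 h\<close>, which is impossible once
    \<open>h\<close> is large.\<close>
  have "ennreal r \<le> limsup (\<lambda>n. H n / of_nat n)"
  proof (rule ccontr)
    assume "\<not> ?thesis"
    then have "limsup (\<lambda>n. H n / of_nat n) < ennreal r" by simp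
    then obtain s where s: "limsup (\<lambda>n. H n / of_nat n) < ennreal s" "ennreal s < ennreal r" "0 \<le> s"
    proof -
      assume lt: "limsup (\<lambda>n. H n / of_nat n) < ennreal r"
      obtain s' where "limsup (\<lambda>n. H n / of_nat n) < s'" "s' < ennreal r"
        using dense[OF lt] by blast
      then show thesis using that by (cases s') auto
    qed
    have "s < r" using s(2,3) by (simp add: ennreal_less_iff)
    obtain n0 where n0: "\<And>n. n0 \<le> n \<Longrightarrow> H n / of_nat n < ennreal s"
      using Limsup_lessD[OF s(1)] by (auto simp: eventually_sequentially)
    \<comment> \<open>Threshold for \<open>log 2 h\<close> beyond which the gain
      \<open>(r - s) * log 2 h\<close> absorbs the constants: solve \<open>s * (log 2 K + log 2 h +
      1) \<le> log 2 (c / C) + r * log 2 h\<close> for \<open>log 2 h\<close>.\<close>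
    define T where "T = (s * (log 2 K + 1) - log 2 (c / C)) / (r - s)"
    \<comment> \<open>The bound \<open>2 ^ Suc n0 \<le> h\<close> will force \<open>n0 < n\<close>,
      so \<open>n\<close> is in the range of the entropy bound and also nonzero, making the division
      by \<open>n\<close> genuine.\<close>
    have "\<exists>\<^sub>F h in at_top. (\<exists>x E. finite E \<and> E \<subseteq> \<Lambda> \<inter> ball x h \<and> c * h powr r \<le> card E)
        \<and> 2 powr T \<le> h \<and> 2 ^ Suc n0 \<le> h"
      by (intro frequently_rev_mp[OF freq] eventually_mono[OF eventually_conj[OF
            eventually_ge_at_top[of "2 powr T"] eventually_ge_at_top[of "2 ^ Suc n0"]]]) auto
    then obtain h x E where E: "finite E" "E \<subseteq> \<Lambda> \<inter> ball x h" "c * h powr r \<le> card E"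
      and h: "2 powr T \<le> h" "2 ^ Suc n0 \<le> h"
      by (auto dest!: frequently_ex)
    have "1 \<le> h" using h(2) one_le_power[of "2 :: real" "Suc n0"] by linarith
    then have Kh: "1 \<le> K * h" "h \<le> K * h"
      using K mult_mono[of 1 K 1 h] by auto
    \<comment> \<open>The first level whose cubes are fine enough for \<open>h\<close>. Rounding up
      costs at most 1, and \<open>1 \<le> K * h\<close> keeps \<open>nat\<close> from
      truncating.\<close>
    define n where "n = nat \<lceil>log 2 (K * h)\<rceil>"
    have log_le: "log 2 (K * h) \<le> n" unfolding n_def by (rule real_nat_ceiling_ge)
    have n_le: "n \<le> log 2 K + log 2 h + 1"
      using Kh K \<open>1 \<le> h\<close> by (simp add: n_def log_mult)
    have Kh_le: "K * h \<le> 2 ^ n"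
      using log_le Kh by (simp add: log_le_iff powr_realpow)
    then have "(2 :: real) ^ Suc n0 \<le> 2 ^ n" using h(2) Kh by linarith
    then have "Suc n0 \<le> n"
      by (rule power_le_imp_le_exp[rotated]) simp
    then have "n0 < n" by simp
    have pos: "0 < c * h powr r" using \<open>0 < c\<close> \<open>1 \<le> h\<close> by simp
    have "T \<le> log 2 h" using h(1) \<open>1 \<le> h\<close> by (simp add: le_log_iff)
    then have "s * (log 2 K + 1) - log 2 (c / C) \<le> log 2 h * (r - s)"
      using \<open>s < r\<close> by (simp add: T_def pos_divide_le_eq)
    then have "s * (log 2 K + log 2 h + 1) \<le> log 2 (c / C) + r * log 2 h"
      by (simp add: algebra_simps)
    also have "\<dots> = log 2 (c * h powr r / C)"
      using \<open>0 < c\<close> \<open>0 < C\<close> \<open>1 \<le> h\<close> by (simp add: log_divide log_mult log_powr)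
    also have "\<dots> \<le> log 2 (card E / C)"
      using E(3) pos \<open>0 < C\<close> by (simp add: divide_right_mono)
    finally have "s * n \<le> log 2 (card E / C)"
      using mult_left_mono[OF n_le s(3)] by linarith
    then have "ennreal (s * n) \<le> ennreal (log 2 (card E / C))"
      by (rule ennreal_leI)
    \<comment> \<open>\<open>E\<close> is nonempty because \<open>card E\<close> is at least the
      positive number \<open>c * h powr r\<close>.\<close>
    also have "\<dots> \<le> H n"
      using entropy[OF E(1,2) _ Kh_le] E(3) pos by fastforce
    finally have "ennreal (s * n) \<le> H n" .
    then have "ennreal (s * n) / of_nat n \<le> H n / of_nat n"
      by (rule divide_right_mono_ennreal)
    then have "ennreal s \<le> H n / of_nat n"
      using \<open>n0 < n\<close> s(3) by (simp add: ennreal_of_nat_eq_real_of_nat divide_ennreal)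
    then show False using n0[of n] \<open>n0 < n\<close> by simp
  qed
  then show "ennreal r \<le> upper_entropy_dim \<mu>"
    unfolding upper_entropy_dim_def upper_entropy_dim_prob_def H_def .
qed

end
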